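(* Let $N=3$, $m>0$, $\kappa>0$ and $\nu_1,\nu_2,\nu_3\in\mathbb R$ satisfy $$m\max_{1\le i,j\le N}|\nu_i-\nu_j|+2m\kappa+\frac{\max_{1\le i,j\le N}|\nu_i-\nu_j|}{2\kappa}<\frac18\sqrt{\frac16\left(69-11\sqrt{33}\right)}.$$ Then, for all initial data, the solution of $$m\ddot\theta_i+\dot\theta_i=\nu_i+\frac{\kappa}{3}\sum_{j=1}^3\sin(\theta_j-\theta_i),\quad t>0,\qquad (\theta_i,\dot\theta_i)(0)=(\theta_i^0,\omega_i^0)\in\mathbb R^2,\quad i\in\{1,2,3\},$$ exhibits asymptotic phase-locking.
   Context: The unknowns $\theta_i$ are real-valued functions on $[0,\infty)$; the Cauchy problem has a unique global solution. A solution exhibits asymptotic phase-locking if for all $i,j$ the limit $\lim_{t\to\infty}(\theta_i(t)-\theta_j(t))$ exists in $\mathbb R$. *)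

theory Defs
  imports "HOL-Analysis.Analysis"
begin

text \<open>
  Oscillators are indexed by \<open>{1..N}\<close>; values of the families at other indices are irrelevant.
\<close>

definition frequency_diameter :: "nat \<Rightarrow> (nat \<Rightarrow> real) \<Rightarrow> real" where
  "frequency_diameter N \<nu> = (MAX (i, j) \<in> {1..N} \<times> {1..N}. \<bar>\<nu> i - \<nu> j\<bar>)"

text \<open>
  Classical solutions of the Cauchy problem: \<open>\<theta> i\<close> is continuously differentiable on \<open>[0, \<infinity>)\<close>
  (one-sided derivative at \<open>0\<close>) with derivative \<open>\<omega> i\<close>, and twice differentiable on \<open>(0, \<infinity>)\<close>,
  where the equation holds.
\<close>

definition inertial_kuramoto_solution ::
  "nat \<Rightarrow> real \<Rightarrow> real \<Rightarrow> (nat \<Rightarrow> real) \<Rightarrow> (nat \<Rightarrow> real) \<Rightarrow> (nat \<Rightarrow> real) \<Rightarrow> (nat \<Rightarrow> real \<Rightarrow> real) \<Rightarrow> bool"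
where
  "inertial_kuramoto_solution N m \<kappa> \<nu> \<theta>0 \<omega>0 \<theta> \<longleftrightarrow>
    (\<exists>\<omega>. \<forall>i\<in>{1..N}.
      (\<forall>t\<ge>0. (\<theta> i has_real_derivative \<omega> i t) (at t within {0..})) \<and>
      continuous_on {0..} (\<omega> i) \<and>
      (\<forall>t>0. \<exists>a. (\<omega> i has_real_derivative a) (at t) \<and>
         m * a + \<omega> i t = \<nu> i + \<kappa> / real N * (\<Sum>j\<in>{1..N}. sin (\<theta> j t - \<theta> i t))) \<and>
      \<theta> i 0 = \<theta>0 i \<and> \<omega> i 0 = \<omega>0 i)"

definition asymptotic_phase_locking :: "nat \<Rightarrow> (nat \<Rightarrow> real \<Rightarrow> real) \<Rightarrow> bool" where
  "asymptotic_phase_locking N \<theta> \<longleftrightarrow>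
    (\<forall>i\<in>{1..N}. \<forall>j\<in>{1..N}. \<exists>L::real. ((\<lambda>t. \<theta> i t - \<theta> j t) \<longlongrightarrow> L) at_top)"

end

theory Submission
  imports Defs "HOL-Computational_Algebra.Polynomial"
begin

text \<open>
  The frequencies of two oscillators eventually differ by at most twice \<open>D + 2 \<kappa>\<close>, where \<open>D\<close> is the
  frequency diameter, because they relax towards the forces, which differ by no more than
  \<open>D + 2 \<kappa>\<close>.  Hence the shifted phases \<open>\<theta> i + m \<omega> i\<close>, whose derivatives are exactly the forces, have
  differences that eventually stay within \<open>2 m (D + 2 \<kappa>)\<close> of the phase differences, and inertia becomes a small
  perturbation of a first-order system.

  In that first-order system the difference \<open>x\<close> of two phases is driven by at most
  \<open>D - 2 \<kappa> / 3 (sin x - \<bar>sin (x / 2)\<bar>)\<close>: the direct coupling contributes \<open>sin x\<close>, and the third oscillator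
  can counteract it by no more than \<open>\<bar>sin (x / 2)\<bar>\<close>, wherever it is.  The function
  \<open>sin x - \<bar>sin (x / 2)\<bar>\<close> has period \<open>2 \<pi>\<close>, and at its maximum its value is three times the
  right-hand side of the smallness hypothesis.  The hypothesis is exactly what keeps this
  bound on the drift negative at each of the levels \<open>2 threshold_angle + 2 n \<pi>\<close> after allowing for the
  perturbation.  No shifted phase difference can cross such a level upwards, and exchanging the two
  oscillators bounds it from below (\<open>phase_difference_bounded_above\<close>).

  Once the phase differences are bounded, the system in the frame moving with the mean phase is a damped
  gradient system with bounded orbits.  Its energy converges, and Barbalat's argument, applied to
  the energy and then to the frequencies, makes the forces equalise (\<open>force_tendsto_mean\<close>).  It remains
  to exclude drifting along a continuum of equilibria.  A value that a phase difference takes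
  at arbitrarily late times is an equilibrium value, so its cosine is a root of a fixed nonzero polynomial
  (\<open>recurrent_phase_difference\<close>); there are only countably many such values, and a continuous
  bounded function with countably many recurrent values converges
  (\<open>convergent_if_countable_recurrent_values\<close>).
\<close>

section \<open>Scalar functions on a half-line\<close>

text \<open>
  Barbalat's lemma.  Over a short time \<open>d\<close> the derivative \<open>g\<close> changes by at most \<open>B d\<close>, so it is close to
  the difference quotient of \<open>f\<close> over that time; with \<open>d\<close> fixed, the quotient tends to \<open>0\<close> since
  \<open>f\<close> converges.
\<close>

lemma derivative_vanishes_at_top:
  fixes f g h :: "real \<Rightarrow> real"
  assumes f: "\<And>t. t \<ge> T \<Longrightarrow> (f has_real_derivative g t) (at t)"
    and g: "\<And>t. t \<ge> T \<Longrightarrow> (g has_real_derivative h t) (at t)"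
    and h: "\<And>t. t \<ge> T \<Longrightarrow> \<bar>h t\<bar> \<le> B"
    and lim: "(f \<longlongrightarrow> L) at_top"
  shows "(g \<longlongrightarrow> 0) at_top"
proof (rule tendstoI)
  fix \<epsilon> :: real assume "\<epsilon> > 0"
  have "B \<ge> 0" using h[of T] by linarith
  \<comment> \<open>Chosen so that \<open>B d \<le> \<epsilon> / 2\<close>; the summand \<open>1\<close> covers \<open>B = 0\<close>.\<close>
  define d where "d = \<epsilon> / (2 * (B + 1))"
  have "d > 0" using \<open>\<epsilon> > 0\<close> \<open>B \<ge> 0\<close> by (simp add: d_def)
  have "filterlim (\<lambda>t. t + d) at_top at_top"
    using filterlim_tendsto_add_at_top[OF tendsto_const[of d] filterlim_ident] by (simp add: add.commute)
  then have "((\<lambda>t. f (t + d)) \<longlongrightarrow> L) at_top"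
    by (rule filterlim_compose[OF lim])
  then have "((\<lambda>t. (f (t + d) - f t) / d) \<longlongrightarrow> (L - L) / d) at_top"
    using \<open>d > 0\<close> lim by (intro tendsto_intros) auto
  then have "\<forall>\<^sub>F t in at_top. dist ((f (t + d) - f t) / d) ((L - L) / d) < \<epsilon> / 2"
    using \<open>\<epsilon> > 0\<close> by (intro tendstoD) auto
  then show "\<forall>\<^sub>F t in at_top. dist (g t) 0 < \<epsilon>"
    using eventually_ge_at_top[of T]
  proof eventually_elim
    case (elim t)
    obtain s where s: "t < s" "s < t + d" "f (t + d) - f t = d * g s"
      using MVT2[of t "t + d" f g] f elim(2) \<open>d > 0\<close> by auto
    obtain r where r: "t < r" "r < s" "g s - g t = (s - t) * h r"
      using MVT2[of t s g h] g elim(2) s(1) by auto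
    have "\<bar>g s - g t\<bar> \<le> d * B"
      unfolding r(3) abs_mult using s r h[of r] elim(2) \<open>d > 0\<close>
      by (intro mult_mono) auto
    also have "\<dots> \<le> d * (B + 1)"
      using \<open>d > 0\<close> by (simp add: algebra_simps)
    also have "\<dots> = \<epsilon> / 2"
      using \<open>B \<ge> 0\<close> by (simp add: d_def field_simps)
    finally have "\<bar>g s - g t\<bar> \<le> \<epsilon> / 2" .
    moreover have "\<bar>g s\<bar> < \<epsilon> / 2"
      using elim(1) s(3) \<open>d > 0\<close> by (simp add: dist_real_def)
    ultimately show ?case unfolding dist_real_def by linarith
  qed
qed

text \<open>
  Multiplying by the integrating factor \<open>exp (t / m)\<close> shows that \<open>(y t - H) exp (t / m)\<close> does not increase;
  the lower bound is the same statement for \<open>- y\<close>.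
\<close>

lemma relaxation_bound:
  fixes y h :: "real \<Rightarrow> real"
  assumes "m > 0"
    and y: "\<And>s. s \<ge> T \<Longrightarrow> (y has_real_derivative (h s - y s) / m) (at s)"
    and h: "\<And>s. s \<ge> T \<Longrightarrow> \<bar>h s\<bar> \<le> H"
    and "T \<le> t"
  shows "\<bar>y t\<bar> \<le> H + \<bar>y T\<bar> * exp ((T - t) / m)"
proof -
  have upper: "z t \<le> H + \<bar>z T\<bar> * exp ((T - t) / m)"
    if z: "\<And>s. s \<ge> T \<Longrightarrow> (z has_real_derivative (k s - z s) / m) (at s)"
      and k: "\<And>s. s \<ge> T \<Longrightarrow> \<bar>k s\<bar> \<le> H" for z k :: "real \<Rightarrow> real"
  proof -
    have "(z T - H) * exp (T / m) \<ge> (z t - H) * exp (t / m)"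
    proof (rule DERIV_nonpos_imp_nonincreasing[OF \<open>T \<le> t\<close>])
      fix s assume "T \<le> s"
      have "((\<lambda>s. (z s - H) * exp (s / m)) has_real_derivative (k s - H) / m * exp (s / m)) (at s)"
        using \<open>m > 0\<close> by (auto intro!: derivative_eq_intros z \<open>T \<le> s\<close> simp: field_simps)
      moreover have "(k s - H) / m * exp (s / m) \<le> 0"
        using k[OF \<open>T \<le> s\<close>] \<open>m > 0\<close>
        by (intro mult_nonpos_nonneg divide_nonpos_pos) auto
      ultimately show "\<exists>v. ((\<lambda>s. (z s - H) * exp (s / m)) has_real_derivative v) (at s) \<and> v \<le> 0"
        by blast
    qed
    then have "(z t - H) * exp (t / m) / exp (t / m) \<le> (z T - H) * exp (T / m) / exp (t / m)"
      by (intro divide_right_mono) auto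
    then have "z t - H \<le> (z T - H) * exp ((T - t) / m)"
      by (simp add: exp_diff diff_divide_distrib)
    also have "\<dots> \<le> \<bar>z T\<bar> * exp ((T - t) / m)"
      using k[of T] by (intro mult_right_mono) auto
    finally show ?thesis by simp
  qed
  have "y t \<le> H + \<bar>y T\<bar> * exp ((T - t) / m)"
    using y h by (rule upper)
  moreover have "- y t \<le> H + \<bar>- y T\<bar> * exp ((T - t) / m)"
    using h by (intro upper[of "\<lambda>s. - y s" "\<lambda>s. - h s"])
      (auto intro!: derivative_eq_intros y simp: minus_divide_left)
  ultimately show ?thesis by auto
qed

lemma eventually_relaxed:
  fixes y h :: "real \<Rightarrow> real"
  assumes "m > 0" "H > 0"
    and y: "\<And>s. s \<ge> T \<Longrightarrow> (y has_real_derivative (h s - y s) / m) (at s)"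
    and h: "\<And>s. s \<ge> T \<Longrightarrow> \<bar>h s\<bar> \<le> H"
  shows "\<forall>\<^sub>F t in at_top. \<bar>y t\<bar> \<le> 2 * H"
  using eventually_ge_at_top[of "T + m * \<bar>y T\<bar> / H"]
proof eventually_elim
  case (elim t)
  have "m * \<bar>y T\<bar> / H \<ge> 0" using assms(1,2) by simp
  then have "T \<le> t" using elim by linarith
  \<comment> \<open>\<open>1 + u \<le> exp u\<close> shows that the initial deviation has shrunk below \<open>H\<close> by then.\<close>
  have "\<bar>y T\<bar> / H \<le> (t - T) / m"
    using elim assms(1,2) by (simp add: field_simps)
  also have "\<dots> \<le> exp ((t - T) / m)"
    using exp_ge_add_one_self[of "(t - T) / m"] by linarith
  finally have "\<bar>y T\<bar> \<le> H * exp ((t - T) / m)"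
    using assms(2) by (simp add: field_simps)
  then have "\<bar>y T\<bar> * exp ((T - t) / m) \<le> H * exp ((t - T) / m) * exp ((T - t) / m)"
    by (intro mult_right_mono) auto
  also have "\<dots> = H"
    by (simp add: mult.assoc flip: exp_add add_divide_distrib)
  finally show ?case
    using relaxation_bound[OF \<open>m > 0\<close> y h \<open>T \<le> t\<close>] by simp
qed

text \<open>
  If the level \<open>c\<close> were reached, then at the first such time \<open>f\<close> would be decreasing, hence above
  \<open>c\<close> just before.
\<close>

lemma barrier_from_below:
  fixes f f' :: "real \<Rightarrow> real"
  assumes f: "\<And>s. s \<ge> T \<Longrightarrow> (f has_real_derivative f' s) (at s)"
    and barrier: "\<And>s. s \<ge> T \<Longrightarrow> f s = c \<Longrightarrow> f' s < 0"
    and "f T < c" "T \<le> t"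
  shows "f t < c"
proof (rule ccontr)
  assume "\<not> f t < c"
  have cont: "continuous_on {T..t} f"
    by (rule DERIV_continuous_on[of _ _ f']) (auto intro: has_field_derivative_at_within[OF f])
  define S where "S = {T..t} \<inter> f -` {c..}"
  have "compact S"
    unfolding S_def compact_eq_bounded_closed
    using continuous_closed_preimage[OF cont closed_atLeastAtMost closed_atLeast[of c]]
    by (auto intro: bounded_subset[of "{T..t}"])
  moreover have "t \<in> S" using \<open>\<not> f t < c\<close> \<open>T \<le> t\<close> by (simp add: S_def)
  \<comment> \<open>The first time at which \<open>c\<close> is reached.\<close>
  ultimately obtain s where s: "s \<in> S" "\<And>r. r \<in> S \<Longrightarrow> s \<le> r"
    using compact_attains_inf[of S] by blast
  have below: "f r < c" if "T \<le> r" "r < s" for r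
    using s that by (force simp: S_def)
  have "T < s" using s(1) \<open>f T < c\<close> by (cases "s = T") (auto simp: S_def)
  have "f s = c"
  proof (rule antisym)
    have "(f \<longlongrightarrow> f s) (at s within {T..s})"
      using f[of s] \<open>T < s\<close> by (meson DERIV_isCont continuous_at_imp_continuous_at_within
          continuous_within less_eq_real_def)
    moreover have "at s within {T..s} = at_left s"
      using \<open>T < s\<close> by (rule at_within_Icc_at_left)
    ultimately have "(f \<longlongrightarrow> f s) (at_left s)" by simp
    moreover have "\<forall>\<^sub>F r in at_left s. f r \<le> c"
      using eventually_at_left_real[OF \<open>T < s\<close>]
      by eventually_elim (auto intro!: less_imp_le below)
    ultimately show "f s \<le> c"
      by (rule tendsto_upperbound) simp
  qed (use s(1) in \<open>simp add: S_def\<close>)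
  then obtain d where d: "d > 0" "\<And>h. h > 0 \<Longrightarrow> h < d \<Longrightarrow> f s < f (s - h)"
    using DERIV_neg_dec_left[OF f barrier] \<open>T < s\<close> by (metis less_imp_le)
  define h where "h = min (d / 2) (s - T)"
  have "f s < f (s - h)" using d \<open>T < s\<close> by (intro d(2)) (auto simp: h_def)
  moreover have "f (s - h) < c" using d \<open>T < s\<close> by (intro below) (auto simp: h_def)
  ultimately show False using \<open>f s = c\<close> by simp
qed

lemma frequently_intermediate_value:
  fixes f :: "real \<Rightarrow> real"
  assumes cont: "continuous_on {T..} f"
    and low: "\<exists>\<^sub>F t in at_top. f t < c" and high: "\<exists>\<^sub>F t in at_top. f t > c"
  shows "\<exists>\<^sub>F t in at_top. f t = c"
  unfolding frequently_def eventually_at_top_linorder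
proof (clarify)
  fix S assume S: "\<forall>t\<ge>S. f t \<noteq> c"
  obtain a where a: "a \<ge> max S T" "f a < c"
    using low unfolding frequently_def eventually_at_top_linorder by blast
  obtain b where b: "b \<ge> max S T" "f b > c"
    using high unfolding frequently_def eventually_at_top_linorder by blast
  have "connected (f ` {max S T..})"
    by (intro connected_continuous_image continuous_on_subset[OF cont]) auto
  then have "c \<in> f ` {max S T..}"
    using a b by (meson atLeast_iff connectedD_interval image_eqI less_imp_le)
  with S show False by auto
qed

text \<open>
  If \<open>f\<close> had a cluster point \<open>L\<close> without converging to it, it would forever oscillate across some
  interval next to \<open>L\<close> and so, by continuity, take every value of that interval at arbitrarily late times.
  An interval is uncountable.
\<close>

lemma convergent_if_countable_recurrent_values:
  fixes f :: "real \<Rightarrow> real"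
  assumes cont: "continuous_on {T..} f"
    and bdd: "\<And>t. t \<ge> T \<Longrightarrow> \<bar>f t\<bar> \<le> B"
    and "countable Z" and recur: "\<And>c. \<exists>\<^sub>F t in at_top. f t = c \<Longrightarrow> c \<in> Z"
  shows "\<exists>L. (f \<longlongrightarrow> L) at_top"
proof -
  define x where "x n = f (T + real n)" for n
  have "bounded (range x)"
    unfolding bounded_iff x_def using bdd by (intro exI[of _ B]) auto
  then obtain L r where r: "strict_mono r" "(x \<circ> r) \<longlonglongrightarrow> L"
    using bounded_imp_convergent_subsequence by blast
  have times: "filterlim (\<lambda>n. T + real (r n)) at_top sequentially"
    by (intro filterlim_tendsto_add_at_top[OF tendsto_const]
        filterlim_compose[OF filterlim_real_sequentially] filterlim_subseq r(1))
  have near: "\<exists>\<^sub>F t in at_top. P (f t)" if "\<forall>\<^sub>F n in sequentially. P ((x \<circ> r) n)" for P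
  proof -
    have "\<exists>\<^sub>F n in sequentially. P (f (T + real (r n)))"
      using that by (intro eventually_frequently) (auto simp: x_def o_def)
    then show ?thesis
      using times unfolding frequently_def filterlim_iff by auto
  qed
  have escape: "\<exists>c. p < c \<and> c < q \<and> c \<notin> Z" if "p < q" for p q :: real
  proof (rule ccontr)
    assume "\<nexists>c. p < c \<and> c < q \<and> c \<notin> Z"
    then have "{p<..<q} \<subseteq> Z" by auto
    then show False
      using \<open>countable Z\<close> \<open>p < q\<close> by (meson countable_subset uncountable_open_interval)
  qed
  have "(f \<longlongrightarrow> L) at_top"
  proof (rule order_tendstoI)
    fix a assume "a < L"
    obtain c where c: "a < c" "c < L" "c \<notin> Z" using escape[OF \<open>a < L\<close>] by blast
    have up: "\<exists>\<^sub>F t in at_top. f t > c"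
      using order_tendstoD(1)[OF r(2) c(2)] by (rule near)
    show "\<forall>\<^sub>F t in at_top. a < f t"
    proof (rule ccontr)
      assume "\<not> ?thesis"
      then have "\<exists>\<^sub>F t in at_top. f t < c"
        unfolding not_eventually by (rule frequently_elim1) (use c in auto)
      then show False
        using frequently_intermediate_value[OF cont _ up] recur c(3) by blast
    qed
  next
    fix a assume "L < a"
    obtain c where c: "L < c" "c < a" "c \<notin> Z" using escape[OF \<open>L < a\<close>] by blast
    have down: "\<exists>\<^sub>F t in at_top. f t < c"
      using order_tendstoD(2)[OF r(2) c(1)] by (rule near)
    show "\<forall>\<^sub>F t in at_top. f t < a"
    proof (rule ccontr)
      assume "\<not> ?thesis"
      then have "\<exists>\<^sub>F t in at_top. f t > c"
        unfolding not_eventually by (rule frequently_elim1) (use c in auto)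
      then show False
        using frequently_intermediate_value[OF cont down] recur c(3) by blast
    qed
  qed
  then show ?thesis by blast
qed

section \<open>Trigonometry of the barrier and of the equilibria\<close>

lemma abs_sin_diff_le: "\<bar>sin x - sin y\<bar> \<le> \<bar>x - y\<bar>" for x y :: real
proof -
  have "\<bar>sin x - sin y\<bar> = 2 * (\<bar>sin ((x - y) / 2)\<bar> * \<bar>cos ((x + y) / 2)\<bar>)"
    unfolding sin_diff_sin by (simp add: abs_mult)
  also have "\<dots> \<le> 2 * (\<bar>(x - y) / 2\<bar> * 1)"
    by (intro mult_left_mono mult_mono abs_sin_x_le_abs_x) auto
  finally show ?thesis by simp
qed

lemma countable_cos_fibre: "countable {x::real. cos x = u}"
proof (cases "\<exists>y. cos y = u")
  case True
  then obtain y where y: "cos y = u" by blast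
  have "x \<in> range (\<lambda>k. 2 * pi * real_of_int k - y) \<union> range (\<lambda>k. y - 2 * pi * real_of_int k)"
    if "cos x = cos y" for x
  proof -
    have "sin ((x + y) / 2) = 0 \<or> sin ((y - x) / 2) = 0"
      using that cos_diff_cos[of x y] by auto
    then obtain k :: int where "(x + y) / 2 = k * pi \<or> (y - x) / 2 = k * pi"
      unfolding sin_zero_iff_int2 by blast
    then have "x = 2 * pi * real_of_int k - y \<or> x = y - 2 * pi * real_of_int k"
      by (auto simp: field_simps)
    then show ?thesis by blast
  qed
  then have "{x. cos x = u} \<subseteq> range (\<lambda>k. 2 * pi * real_of_int k - y) \<union> range (\<lambda>k. y - 2 * pi * real_of_int k)"
    using y by (auto simp del: Un_iff)
  then show ?thesis by (rule countable_subset) auto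
qed auto

text \<open>
  The maximum point of \<open>sin (2 y) - sin y\<close> for \<open>y\<close> between \<open>0\<close> and \<open>\<pi>\<close>: its cosine is the positive root of
  \<open>4 c\<^sup>2 - c - 2 = 0\<close>.
\<close>

definition threshold_angle :: real where
  "threshold_angle = arccos ((1 + sqrt 33) / 8)"

lemma threshold_angle_value:
  "sin (2 * threshold_angle) - \<bar>sin threshold_angle\<bar>
     = 3 * (1 / 8 * sqrt (1 / 6 * (69 - 11 * sqrt 33)))"
proof -
  define q :: real where "q = sqrt 33"
  have q2: "q * q = 33" and "q \<ge> 0" by (simp_all add: q_def)
  have q: "5 \<le> q" "q \<le> 6" unfolding q_def by (auto intro: real_le_lsqrt real_le_rsqrt)
  have c: "cos threshold_angle = (1 + q) / 8"
    unfolding threshold_angle_def q_def[symmetric] using q by (intro cos_arccos) auto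
  have s: "sin threshold_angle \<ge> 0"
    unfolding threshold_angle_def q_def[symmetric] sin_arccos[of "(1+q)/8"] using q
    by (intro sin_ge_zero arccos_lbound arccos_ubound) auto
  have s2: "(sin threshold_angle)\<^sup>2 = (15 - q) / 32"
    unfolding sin_squared_eq c using q2 by (simp add: power2_eq_square field_simps)
  have "sin (2 * threshold_angle) - \<bar>sin threshold_angle\<bar> = sin threshold_angle * ((q - 3) / 4)"
    using s unfolding sin_double c by (simp add: field_simps)
  moreover have "sin threshold_angle * ((q - 3) / 4) \<ge> 0" using s q by auto
  moreover have "(sin threshold_angle * ((q - 3) / 4))\<^sup>2 = 9 / 64 * (1 / 6 * (69 - 11 * q))"
  proof -
    have "(q - 3) * (q - 3) = 42 - 6 * q"
      using q2 by (simp add: algebra_simps)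
    then have "(15 - q) * ((q - 3) * (q - 3)) = 630 - 132 * q + 6 * (q * q)"
      by (simp add: algebra_simps)
    then have "(15 - q) * ((q - 3) * (q - 3)) = 828 - 132 * q"
      using q2 by simp
    then show ?thesis
      unfolding power_mult_distrib s2 by (simp add: power2_eq_square field_simps)
  qed
  \<comment> \<open>Both sides are nonnegative with the same square.\<close>
  ultimately have "sin (2 * threshold_angle) - \<bar>sin threshold_angle\<bar> = sqrt (9 / 64 * (1 / 6 * (69 - 11 * q)))"
    by (metis real_sqrt_abs abs_of_nonneg)
  also have "\<dots> = sqrt (9 / 64) * sqrt (1 / 6 * (69 - 11 * q))"
    by (rule real_sqrt_mult)
  also have "sqrt (9 / 64 :: real) = 3 / 8"
    by (rule real_sqrt_unique) (auto simp: power2_eq_square)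
  finally show ?thesis by (simp add: q_def)
qed

text \<open>
  At an equilibrium of three oscillators, let \<open>x\<close> be the difference of two phases and \<open>\<xi>\<close> the position of
  the third phase relative to their midpoint.  The balance of forces amounts to one equation for
  \<open>sin (x / 2) cos \<xi>\<close> and one for \<open>cos (x / 2) sin \<xi>\<close>.  Eliminating \<open>\<xi>\<close> by \<open>cos\<^sup>2 \<xi> + sin\<^sup>2 \<xi> = 1\<close> leaves a
  relation of the form \<open>E(cos x) = 12 d sin x (1 + cos x)\<close>, and squaring removes \<open>sin x\<close>.  The resulting
  polynomial in \<open>u = cos x\<close> is this one.
\<close>

definition equilibrium_resultant :: "real \<Rightarrow> real \<Rightarrow> real \<Rightarrow> real" where
  "equilibrium_resultant d a u =
     (9 * d\<^sup>2 * (1 + u) + 4 * (1 - u\<^sup>2) * (1 + u) + 9 * a\<^sup>2 * (1 - u) - 2 * (1 - u\<^sup>2))\<^sup>2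
       - 144 * d\<^sup>2 * (1 - u\<^sup>2) * (1 + u)\<^sup>2"

lemma equilibrium_resultant_eq_0:
  assumes d: "3 / 2 * d = sin x + sin (x / 2) * cos \<xi>"
    and a: "3 / 2 * a = cos (x / 2) * sin \<xi>"
  shows "equilibrium_resultant d a (cos x) = 0"
proof -
  define s c where "s = sin (x / 2)" and "c = cos (x / 2)"
  have half: "sin x = 2 * s * c" "1 + cos x = 2 * c\<^sup>2" "1 - cos x = 2 * s\<^sup>2"
    using sin_double[of "x / 2"] cos_double_sin[of "x / 2"] cos_double_cos[of "x / 2"]
    by (simp_all add: s_def c_def)
  have "1 - (cos x)\<^sup>2 = (sin x)\<^sup>2" by (simp add: sin_squared_eq)
  have sum: "(s * c * cos \<xi>)\<^sup>2 + (s * c * sin \<xi>)\<^sup>2 = (s * c)\<^sup>2"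
    by (simp add: power_mult_distrib flip: distrib_left)
  have s: "s * cos \<xi> = 3 / 2 * d - sin x" using d unfolding s_def by linarith
  have c: "c * sin \<xi> = 3 / 2 * a" using a by (simp add: c_def)
  have "(c * (3 / 2 * d - sin x))\<^sup>2 + (s * (3 / 2 * a))\<^sup>2 = (s * c)\<^sup>2"
    using sum unfolding s[symmetric] c[symmetric] by (simp add: ac_simps)
  then have "8 * (c\<^sup>2 * (3 / 2 * d - sin x)\<^sup>2 + s\<^sup>2 * (3 / 2 * a)\<^sup>2) = 8 * (s * c)\<^sup>2"
    by (simp only: power_mult_distrib)
  then have "4 * ((2 * c\<^sup>2) * (3 / 2 * d - sin x)\<^sup>2 + (2 * s\<^sup>2) * (3 / 2 * a)\<^sup>2) = 2 * (2 * s * c)\<^sup>2"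
    by (simp add: power_mult_distrib)
  then have "4 * ((1 + cos x) * (3 / 2 * d - sin x)\<^sup>2 + (1 - cos x) * (3 / 2 * a)\<^sup>2) = 2 * (sin x)\<^sup>2"
    unfolding half .
  then have "9 * d\<^sup>2 * (1 + cos x) + 4 * (sin x)\<^sup>2 * (1 + cos x) + 9 * a\<^sup>2 * (1 - cos x) - 2 * (sin x)\<^sup>2
      = 12 * d * sin x * (1 + cos x)"
    by (simp add: power2_eq_square field_simps)
  then show ?thesis
    unfolding equilibrium_resultant_def \<open>1 - (cos x)\<^sup>2 = (sin x)\<^sup>2\<close>
    by (simp add: power_mult_distrib)
qed

text \<open>
  The polynomial is nonzero because its value at \<open>2\<close> is: there \<open>1 - u\<^sup>2\<close> is negative, so the value is a sum of
  two squares that do not vanish together.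
\<close>

lemma finite_equilibrium_resultant_roots: "finite {u. equilibrium_resultant d a u = 0}"
proof -
  define X :: "real poly" where "X = [:0, 1:]"
  define p where "p = (smult (9 * d\<^sup>2) (1 + X) + smult 4 (1 - X\<^sup>2) * (1 + X)
      + smult (9 * a\<^sup>2) (1 - X) - smult 2 (1 - X\<^sup>2))\<^sup>2 - smult (144 * d\<^sup>2) (1 - X\<^sup>2) * (1 + X)\<^sup>2"
  have poly: "poly p u = equilibrium_resultant d a u" for u
    unfolding p_def X_def equilibrium_resultant_def
    by (simp only: poly_add poly_diff poly_smult poly_mult poly_power poly_pCons poly_1 poly_0 mult_zero_right mult_1_right add_0_left add_0_right)
  have "equilibrium_resultant d a 2 \<noteq> 0"
  proof (cases "d = 0")
    case True
    have "- 30 - 9 * a\<^sup>2 \<noteq> 0"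
      using zero_le_power2[of a] by linarith
    then show ?thesis by (simp add: equilibrium_resultant_def True)
  next
    case False
    have "equilibrium_resultant d a 2 = (27 * d\<^sup>2 - 9 * a\<^sup>2 - 30)\<^sup>2 + 3888 * d\<^sup>2"
      by (simp add: equilibrium_resultant_def)
    also have "\<dots> > 0" using False by (intro add_nonneg_pos) auto
    finally show ?thesis by simp
  qed
  then have "p \<noteq> 0" using poly by force
  then show ?thesis using poly_roots_finite[of p] by (simp add: poly)
qed

section \<open>Energy dissipation for any number of oscillators\<close>

definition coupled_force :: "nat \<Rightarrow> real \<Rightarrow> (nat \<Rightarrow> real) \<Rightarrow> (nat \<Rightarrow> real \<Rightarrow> real) \<Rightarrow> nat \<Rightarrow> real \<Rightarrow> real" where
  "coupled_force N \<kappa> \<nu> \<theta> i t = \<nu> i + \<kappa> / real N * (\<Sum>j\<in>{1..N}. sin (\<theta> j t - \<theta> i t))"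

lemma abs_coupled_force_le:
  assumes "i \<in> {1..N}"
  shows "\<bar>coupled_force N \<kappa> \<nu> \<theta> i t\<bar> \<le> \<bar>\<nu> i\<bar> + \<bar>\<kappa>\<bar>"
proof -
  have "\<bar>\<Sum>j\<in>{1..N}. sin (\<theta> j t - \<theta> i t)\<bar> \<le> (\<Sum>j\<in>{1..N}. 1)"
    by (intro order_trans[OF sum_abs] sum_mono) simp
  then have "\<bar>\<kappa>\<bar> / real N * \<bar>\<Sum>j\<in>{1..N}. sin (\<theta> j t - \<theta> i t)\<bar> \<le> \<bar>\<kappa>\<bar> / real N * real N"
    by (intro mult_left_mono) auto
  also have "\<dots> = \<bar>\<kappa>\<bar>" using assms by auto
  finally show ?thesis
    unfolding coupled_force_def by (intro order_trans[OF abs_triangle_ineq]) (simp add: abs_mult)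
qed

lemma sum_antisymmetric_eq_0:
  fixes g :: "'a \<Rightarrow> 'a \<Rightarrow> real"
  assumes "\<And>i j. g i j = - g j i"
  shows "(\<Sum>i\<in>A. \<Sum>j\<in>A. g i j) = 0"
proof -
  have "(\<Sum>i\<in>A. \<Sum>j\<in>A. g i j) = (\<Sum>i\<in>A. \<Sum>j\<in>A. g j i)"
    by (rule sum.swap)
  also have "\<dots> = - (\<Sum>i\<in>A. \<Sum>j\<in>A. g i j)"
    by (subst assms) (simp add: sum_negf)
  finally show ?thesis by simp
qed

text \<open>
  Only positive times matter for the asymptotics, so the equations are recorded there, with two-sided
  derivatives.
\<close>

locale kuramoto_trajectory =
  fixes N :: nat and m \<kappa> :: real and \<nu> :: "nat \<Rightarrow> real" and \<theta> \<omega> :: "nat \<Rightarrow> real \<Rightarrow> real"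
  assumes m_pos: "m > 0"
    and phase_deriv: "\<And>i t. i \<in> {1..N} \<Longrightarrow> t > 0 \<Longrightarrow> (\<theta> i has_real_derivative \<omega> i t) (at t)"
    and frequency_deriv: "\<And>i t. i \<in> {1..N} \<Longrightarrow> t > 0 \<Longrightarrow>
      (\<omega> i has_real_derivative (coupled_force N \<kappa> \<nu> \<theta> i t - \<omega> i t) / m) (at t)"
begin

abbreviation force :: "nat \<Rightarrow> real \<Rightarrow> real" where
  "force \<equiv> coupled_force N \<kappa> \<nu> \<theta>"

lemma force_deriv:
  assumes "i \<in> {1..N}" "t > 0"
  shows "(force i has_real_derivative
    \<kappa> / real N * (\<Sum>j\<in>{1..N}. cos (\<theta> j t - \<theta> i t) * (\<omega> j t - \<omega> i t))) (at t)"
  unfolding coupled_force_def using assms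
  by (auto intro!: derivative_eq_intros phase_deriv sum.cong)

text \<open>
  Kinetic energy plus the potential whose negative gradient is the force: the Kuramoto coupling is
  the gradient of a cosine interaction, and the natural frequencies add a linear tilt.  The tilt
  can make the energy unbounded below, which is why boundedness of the phases has to come first.
\<close>

definition energy :: "real \<Rightarrow> real" where
  "energy t = m / 2 * (\<Sum>i\<in>{1..N}. (\<omega> i t)\<^sup>2) - (\<Sum>i\<in>{1..N}. \<nu> i * \<theta> i t)
     - \<kappa> / (2 * real N) * (\<Sum>i\<in>{1..N}. \<Sum>j\<in>{1..N}. cos (\<theta> j t - \<theta> i t))"

text \<open>
  Damping is the only source of change.  In the derivative of the interaction term the two
  ends of each pair contribute equally, by antisymmetry of the sine, and this
  cancels the factor \<open>1 / 2\<close> that compensates for counting pairs twice.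
\<close>

lemma energy_deriv:
  assumes "t > 0"
  shows "(energy has_real_derivative - (\<Sum>i\<in>{1..N}. (\<omega> i t)\<^sup>2)) (at t)"
proof -
  let ?I = "{1..N}"
  define A where "A i j = sin (\<theta> j t - \<theta> i t)" for i j
  have swap: "(\<Sum>i\<in>?I. \<Sum>j\<in>?I. A i j * \<omega> j t) = - (\<Sum>i\<in>?I. \<Sum>j\<in>?I. A i j * \<omega> i t)"
  proof -
    have "(\<Sum>i\<in>?I. \<Sum>j\<in>?I. A i j * (\<omega> i t + \<omega> j t)) = 0"
    proof (rule sum_antisymmetric_eq_0)
      fix i j
      have "A j i = - A i j" by (simp add: A_def flip: sin_minus)
      then show "A i j * (\<omega> i t + \<omega> j t) = - (A j i * (\<omega> j t + \<omega> i t))" by simp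
    qed
    then show ?thesis by (simp add: distrib_left sum.distrib)
  qed
  have "(energy has_real_derivative
      (\<Sum>i\<in>?I. \<omega> i t * (force i t - \<omega> i t)) - (\<Sum>i\<in>?I. \<nu> i * \<omega> i t)
        + \<kappa> / (2 * real N) * (\<Sum>i\<in>?I. \<Sum>j\<in>?I. A i j * (\<omega> j t - \<omega> i t))) (at t)"
  proof -
    have kinetic: "((\<lambda>t. m / 2 * (\<Sum>i\<in>?I. (\<omega> i t)\<^sup>2)) has_real_derivative
        m / 2 * (\<Sum>i\<in>?I. 2 * \<omega> i t * ((force i t - \<omega> i t) / m))) (at t)"
      using assms by (intro DERIV_cmult) (auto intro!: derivative_eq_intros frequency_deriv sum.cong)
    have "m / 2 * (\<Sum>i\<in>?I. 2 * \<omega> i t * ((force i t - \<omega> i t) / m)) = (\<Sum>i\<in>?I. \<omega> i t * (force i t - \<omega> i t))"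
      unfolding sum_distrib_left using m_pos by (intro sum.cong) auto
    moreover have "((\<lambda>t. \<Sum>i\<in>?I. \<nu> i * \<theta> i t) has_real_derivative (\<Sum>i\<in>?I. \<nu> i * \<omega> i t)) (at t)"
      using assms by (auto intro!: derivative_eq_intros phase_deriv simp: mult.commute)
    moreover have "((\<lambda>t. \<Sum>i\<in>?I. \<Sum>j\<in>?I. cos (\<theta> j t - \<theta> i t)) has_real_derivative
        (\<Sum>i\<in>?I. \<Sum>j\<in>?I. - A i j * (\<omega> j t - \<omega> i t))) (at t)"
      unfolding A_def using assms by (auto intro!: derivative_eq_intros phase_deriv)
    ultimately have "((\<lambda>t. energy t) has_real_derivative
        (\<Sum>i\<in>?I. \<omega> i t * (force i t - \<omega> i t)) - (\<Sum>i\<in>?I. \<nu> i * \<omega> i t)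
          - \<kappa> / (2 * real N) * (\<Sum>i\<in>?I. \<Sum>j\<in>?I. - A i j * (\<omega> j t - \<omega> i t))) (at t)"
      unfolding energy_def using kinetic by (intro DERIV_diff DERIV_cmult) auto
    then show ?thesis by (simp add: sum_negf)
  qed
  moreover have "(\<Sum>i\<in>?I. \<Sum>j\<in>?I. A i j * (\<omega> j t - \<omega> i t)) = - 2 * (\<Sum>i\<in>?I. \<Sum>j\<in>?I. A i j * \<omega> i t)"
    using swap by (simp add: right_diff_distrib sum_subtractf)
  moreover have "(\<Sum>i\<in>?I. \<omega> i t * (force i t - \<omega> i t)) = (\<Sum>i\<in>?I. \<nu> i * \<omega> i t)
      + \<kappa> / real N * (\<Sum>i\<in>?I. \<Sum>j\<in>?I. A i j * \<omega> i t) - (\<Sum>i\<in>?I. (\<omega> i t)\<^sup>2)"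
    unfolding coupled_force_def A_def
    by (simp add: algebra_simps sum.distrib sum_subtractf sum_distrib_left sum_distrib_right power2_eq_square)
  ultimately show ?thesis by (simp del: minus_add_distrib)
qed

lemma frequency_bounded:
  assumes "i \<in> {1..N}" "0 < T" "T \<le> t"
  shows "\<bar>\<omega> i t\<bar> \<le> \<bar>\<nu> i\<bar> + \<bar>\<kappa>\<bar> + \<bar>\<omega> i T\<bar>"
proof -
  have "\<bar>\<omega> i t\<bar> \<le> \<bar>\<nu> i\<bar> + \<bar>\<kappa>\<bar> + \<bar>\<omega> i T\<bar> * exp ((T - t) / m)"
    using assms
    by (intro relaxation_bound[OF m_pos, where h = "force i"] frequency_deriv abs_coupled_force_le) auto
  also have "\<bar>\<omega> i T\<bar> * exp ((T - t) / m) \<le> \<bar>\<omega> i T\<bar> * 1"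
    using assms m_pos by (intro mult_left_mono) (auto simp: divide_le_0_iff)
  finally show ?thesis by simp
qed

text \<open>
  Bounded phases keep the energy bounded below, so it converges; Barbalat's lemma turns this into
  vanishing dissipation.  The frequencies then converge to \<open>0\<close>, and a second use of the lemma makes
  the accelerations vanish, which leaves the force.
\<close>

lemma equilibration:
  assumes "T > 0" and bdd: "\<And>i t. i \<in> {1..N} \<Longrightarrow> t \<ge> T \<Longrightarrow> \<bar>\<theta> i t\<bar> \<le> B"
    and i: "i \<in> {1..N}"
  shows "(\<omega> i \<longlongrightarrow> 0) at_top" "(force i \<longlongrightarrow> 0) at_top"
proof -
  define W where "W j = \<bar>\<nu> j\<bar> + \<bar>\<kappa>\<bar> + \<bar>\<omega> j T\<bar>" for j
  have W: "\<bar>\<omega> j t\<bar> \<le> W j" if "j \<in> {1..N}" "t \<ge> T" for j t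
    unfolding W_def using frequency_bounded that \<open>T > 0\<close> by blast
  have accel: "\<bar>(force j t - \<omega> j t) / m\<bar> \<le> 2 * W j / m" if "j \<in> {1..N}" "t \<ge> T" for j t
  proof -
    have "\<bar>force j t - \<omega> j t\<bar> \<le> 2 * W j"
      using W[OF that] abs_coupled_force_le[OF that(1), of \<kappa> \<nu> \<theta> t]
        abs_triangle_ineq4[of "force j t" "\<omega> j t"] abs_ge_zero[of "\<omega> j T"]
      unfolding W_def by argo
    then show ?thesis using m_pos by (simp add: abs_divide divide_right_mono)
  qed
  define P where "P t = (\<Sum>j\<in>{1..N}. (\<omega> j t)\<^sup>2)" for t
  have energy': "(energy has_real_derivative - P t) (at t)" if "t \<ge> T" for t
    unfolding P_def using energy_deriv that \<open>T > 0\<close> by simp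
  have energy_lower: "energy t \<ge> - (\<Sum>j\<in>{1..N}. \<bar>\<nu> j\<bar> * B) - \<bar>\<kappa>\<bar> / (2 * real N) * (\<Sum>j\<in>{1..N}. \<Sum>k\<in>{1..N}. 1)"
    (is "_ \<ge> - ?U - ?V") if "t \<ge> T" for t
  proof -
    have "(\<Sum>j\<in>{1..N}. \<nu> j * \<theta> j t) \<le> ?U"
    proof (intro sum_mono)
      fix j assume j: "j \<in> {1..N}"
      have "\<nu> j * \<theta> j t \<le> \<bar>\<nu> j\<bar> * \<bar>\<theta> j t\<bar>" by (metis abs_ge_self abs_mult)
      also have "\<dots> \<le> \<bar>\<nu> j\<bar> * B" using bdd[OF j that] by (intro mult_left_mono) auto
      finally show "\<nu> j * \<theta> j t \<le> \<bar>\<nu> j\<bar> * B" .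
    qed
    moreover have "\<bar>\<kappa> / (2 * real N) * (\<Sum>j\<in>{1..N}. \<Sum>k\<in>{1..N}. cos (\<theta> k t - \<theta> j t))\<bar> \<le> ?V"
    proof -
      have "\<bar>\<Sum>j\<in>{1..N}. \<Sum>k\<in>{1..N}. cos (\<theta> k t - \<theta> j t)\<bar> \<le> (\<Sum>j\<in>{1..N}. \<Sum>k\<in>{1..N}. 1)"
        by (intro order_trans[OF sum_abs] sum_mono) simp
      then show ?thesis unfolding abs_mult abs_divide by (intro mult_mono) auto
    qed
    moreover have "m / 2 * (\<Sum>i\<in>{1..N}. (\<omega> i t)\<^sup>2) \<ge> 0"
      using m_pos by (intro mult_nonneg_nonneg sum_nonneg) auto
    ultimately show ?thesis unfolding energy_def by linarith
  qed
  have energy_mono: "energy t \<le> energy s" if "T \<le> s" "s \<le> t" for s t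
    using that by (intro DERIV_nonpos_imp_nonincreasing[OF that(2)])
      (auto intro!: exI energy' sum_nonneg simp: P_def)
  have "bdd_below (energy ` {T..})"
    using energy_lower by (intro bdd_belowI2) auto
  have "(energy \<longlongrightarrow> (INF s\<in>{T..}. energy s)) at_top"
  proof (rule decreasing_tendsto)
    show "\<forall>\<^sub>F t in at_top. (INF s\<in>{T..}. energy s) \<le> energy t"
      using eventually_ge_at_top[of T]
      by eventually_elim (auto intro: cINF_lower \<open>bdd_below (energy ` {T..})\<close>)
    fix x assume "(INF s\<in>{T..}. energy s) < x"
    then obtain s where s: "s \<ge> T" "energy s < x"
      by (subst (asm) cINF_less_iff) (use \<open>bdd_below (energy ` {T..})\<close> in auto)
    show "\<forall>\<^sub>F t in at_top. energy t < x"
      using eventually_ge_at_top[of s]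
      by eventually_elim (use energy_mono s in fastforce)
  qed
  then have "((\<lambda>t. - P t) \<longlongrightarrow> 0) at_top"
  proof (rule derivative_vanishes_at_top[rotated -1])
    fix t assume t: "t \<ge> T"
    show "(energy has_real_derivative - P t) (at t)" using energy'[OF t] .
    show "((\<lambda>t. - P t) has_real_derivative
        - (\<Sum>j\<in>{1..N}. 2 * \<omega> j t * ((force j t - \<omega> j t) / m))) (at t)"
      unfolding P_def using t \<open>T > 0\<close>
      by (auto intro!: derivative_eq_intros frequency_deriv sum.cong)
    have "\<bar>\<Sum>j\<in>{1..N}. 2 * \<omega> j t * ((force j t - \<omega> j t) / m)\<bar> \<le> (\<Sum>j\<in>{1..N}. 2 * W j * (2 * W j / m))"
    proof (intro order_trans[OF sum_abs] sum_mono)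
      fix j assume j: "j \<in> {1..N}"
      show "\<bar>2 * \<omega> j t * ((force j t - \<omega> j t) / m)\<bar> \<le> 2 * W j * (2 * W j / m)"
        unfolding abs_mult[of "2 * \<omega> j t"] using W[OF j t] accel[OF j t]
        by (intro mult_mono) auto
    qed
    then show "\<bar>- (\<Sum>j\<in>{1..N}. 2 * \<omega> j t * ((force j t - \<omega> j t) / m))\<bar>
        \<le> (\<Sum>j\<in>{1..N}. 2 * W j * (2 * W j / m))" by simp
  qed
  then have "(P \<longlongrightarrow> 0) at_top" using tendsto_minus by fastforce
  have "(\<omega> i t)\<^sup>2 \<le> P t" for t
    unfolding P_def using i by (intro member_le_sum) auto
  then have "((\<lambda>t. (\<omega> i t)\<^sup>2) \<longlongrightarrow> 0) at_top"
    by (intro tendsto_sandwich[OF _ _ tendsto_const \<open>(P \<longlongrightarrow> 0) at_top\<close>] always_eventually) auto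
  then show "(\<omega> i \<longlongrightarrow> 0) at_top"
    using tendsto_real_sqrt by (fastforce intro: tendsto_rabs_zero_cancel)
  then have "((\<lambda>t. (force i t - \<omega> i t) / m) \<longlongrightarrow> 0) at_top"
  proof (rule derivative_vanishes_at_top[rotated -1])
    fix t assume t: "t \<ge> T"
    then have "t > 0" using \<open>T > 0\<close> by simp
    show "(\<omega> i has_real_derivative (force i t - \<omega> i t) / m) (at t)"
      using frequency_deriv[OF i \<open>t > 0\<close>] .
    let ?F' = "\<kappa> / real N * (\<Sum>j\<in>{1..N}. cos (\<theta> j t - \<theta> i t) * (\<omega> j t - \<omega> i t))"
    show "((\<lambda>t. (force i t - \<omega> i t) / m) has_real_derivative
        (?F' - (force i t - \<omega> i t) / m) / m) (at t)"
      by (intro DERIV_cdivide DERIV_diff force_deriv frequency_deriv i \<open>t > 0\<close>)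
    have "\<bar>?F'\<bar> \<le> \<bar>\<kappa>\<bar> / real N * (\<Sum>j\<in>{1..N}. W j + W i)"
    proof -
      have "\<bar>\<Sum>j\<in>{1..N}. cos (\<theta> j t - \<theta> i t) * (\<omega> j t - \<omega> i t)\<bar> \<le> (\<Sum>j\<in>{1..N}. W j + W i)"
      proof (intro order_trans[OF sum_abs] sum_mono)
        fix j assume j: "j \<in> {1..N}"
        have "\<bar>cos (\<theta> j t - \<theta> i t) * (\<omega> j t - \<omega> i t)\<bar> \<le> 1 * \<bar>\<omega> j t - \<omega> i t\<bar>"
          unfolding abs_mult by (intro mult_right_mono) auto
        also have "\<dots> \<le> W j + W i"
          using W[OF j t] W[OF i t] abs_triangle_ineq4[of "\<omega> j t" "\<omega> i t"] by argo
        finally show "\<bar>cos (\<theta> j t - \<theta> i t) * (\<omega> j t - \<omega> i t)\<bar> \<le> W j + W i" .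
      qed
      then show ?thesis unfolding abs_mult[of "\<kappa> / real N"] abs_divide by (intro mult_mono) auto
    qed
    then have "\<bar>?F' - (force i t - \<omega> i t) / m\<bar> \<le> \<bar>\<kappa>\<bar> / real N * (\<Sum>j\<in>{1..N}. W j + W i) + 2 * W i / m"
      using accel[OF i t] by linarith
    then show "\<bar>(?F' - (force i t - \<omega> i t) / m) / m\<bar>
        \<le> (\<bar>\<kappa>\<bar> / real N * (\<Sum>j\<in>{1..N}. W j + W i) + 2 * W i / m) / m"
      unfolding abs_divide[of "?F' - _"] using m_pos by (auto intro!: divide_right_mono)
  qed
  then have "((\<lambda>t. m * ((force i t - \<omega> i t) / m) + \<omega> i t) \<longlongrightarrow> m * 0 + 0) at_top"
    using \<open>(\<omega> i \<longlongrightarrow> 0) at_top\<close> by (intro tendsto_intros)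
  then show "(force i \<longlongrightarrow> 0) at_top" using m_pos by simp
qed

definition mean :: "(nat \<Rightarrow> real) \<Rightarrow> real" where
  "mean x = (\<Sum>j\<in>{1..N}. x j) / real N"

text \<open>
  The coupling depends on phase differences only, so subtracting the mean motion yields a trajectory with
  centred natural frequencies.  Bounded phase differences become bounded phases in this frame.
\<close>

lemma force_centred:
  "coupled_force N \<kappa> (\<lambda>i. \<nu> i - mean \<nu>) (\<lambda>i t. \<theta> i t - mean (\<lambda>j. \<theta> j t)) i t = force i t - mean \<nu>"
  unfolding coupled_force_def by simp

lemma mean_force: "mean (\<lambda>i. force i t) = mean \<nu>"
proof -
  have "(\<Sum>i\<in>{1..N}. \<Sum>j\<in>{1..N}. sin (\<theta> j t - \<theta> i t)) = 0"
    by (rule sum_antisymmetric_eq_0) (simp flip: sin_minus)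
  moreover have "(\<Sum>i\<in>{1..N}. force i t)
      = (\<Sum>i\<in>{1..N}. \<nu> i) + \<kappa> / real N * (\<Sum>i\<in>{1..N}. \<Sum>j\<in>{1..N}. sin (\<theta> j t - \<theta> i t))"
    unfolding coupled_force_def sum.distrib by (simp only: sum_distrib_left)
  ultimately show ?thesis by (simp add: mean_def)
qed

lemma centred_trajectory:
  "kuramoto_trajectory N m \<kappa> (\<lambda>i. \<nu> i - mean \<nu>)
     (\<lambda>i t. \<theta> i t - mean (\<lambda>j. \<theta> j t)) (\<lambda>i t. \<omega> i t - mean (\<lambda>j. \<omega> j t))"
proof
  fix i :: nat and t :: real assume i: "i \<in> {1..N}" and t: "t > 0"
  show "((\<lambda>t. \<theta> i t - mean (\<lambda>j. \<theta> j t)) has_real_derivative \<omega> i t - mean (\<lambda>j. \<omega> j t)) (at t)"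
    unfolding mean_def using i t by (auto intro!: derivative_eq_intros phase_deriv)
  have "((\<lambda>t. \<omega> i t - mean (\<lambda>j. \<omega> j t)) has_real_derivative
      (force i t - \<omega> i t) / m - mean (\<lambda>j. (force j t - \<omega> j t) / m)) (at t)"
    unfolding mean_def using i t by (auto intro!: derivative_eq_intros frequency_deriv)
  moreover have "mean (\<lambda>j. (force j t - \<omega> j t) / m) = (mean \<nu> - mean (\<lambda>j. \<omega> j t)) / m"
  proof -
    have "mean (\<lambda>j. (force j t - \<omega> j t) / m) = (mean (\<lambda>j. force j t) - mean (\<lambda>j. \<omega> j t)) / m"
      by (simp add: mean_def sum_subtractf diff_divide_distrib mult.commute flip: sum_divide_distrib)
    then show ?thesis by (simp only: mean_force)
  qed
  moreover have drift: "(force i t - \<omega> i t) / m - (mean \<nu> - mean (\<lambda>j. \<omega> j t)) / m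
      = (force i t - mean \<nu> - (\<omega> i t - mean (\<lambda>j. \<omega> j t))) / m"
    by (simp add: diff_divide_distrib)
  ultimately show "((\<lambda>t. \<omega> i t - mean (\<lambda>j. \<omega> j t)) has_real_derivative
      (coupled_force N \<kappa> (\<lambda>i. \<nu> i - mean \<nu>) (\<lambda>i t. \<theta> i t - mean (\<lambda>j. \<theta> j t)) i t
        - (\<omega> i t - mean (\<lambda>j. \<omega> j t))) / m) (at t)"
    unfolding force_centred by (simp only: drift)
qed (rule m_pos)

lemma force_tendsto_mean:
  assumes "T > 0" and i: "i \<in> {1..N}"
    and bdd: "\<And>i j t. i \<in> {1..N} \<Longrightarrow> j \<in> {1..N} \<Longrightarrow> t \<ge> T \<Longrightarrow> \<bar>\<theta> i t - \<theta> j t\<bar> \<le> B"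
  shows "(force i \<longlongrightarrow> mean \<nu>) at_top"
proof -
  interpret centred: kuramoto_trajectory N m \<kappa> "\<lambda>i. \<nu> i - mean \<nu>"
    "\<lambda>i t. \<theta> i t - mean (\<lambda>j. \<theta> j t)" "\<lambda>i t. \<omega> i t - mean (\<lambda>j. \<omega> j t)"
    by (rule centred_trajectory)
  have "\<bar>\<theta> j t - mean (\<lambda>j. \<theta> j t)\<bar> \<le> B" if j: "j \<in> {1..N}" and t: "t \<ge> T" for j t
  proof -
    have "\<theta> j t - mean (\<lambda>j. \<theta> j t) = (\<Sum>k\<in>{1..N}. \<theta> j t - \<theta> k t) / real N"
      using j by (simp add: mean_def sum_subtractf field_simps)
    also have "\<bar>\<dots>\<bar> \<le> (\<Sum>k\<in>{1..N}. B) / real N"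
      unfolding abs_divide using bdd j t
      by (auto intro!: divide_right_mono order_trans[OF sum_abs] sum_mono simp del: sum_constant)
    also have "\<dots> = B" using j by simp
    finally show ?thesis .
  qed
  then have "((\<lambda>t. force i t - mean \<nu>) \<longlongrightarrow> 0) at_top"
    using centred.equilibration(2)[OF \<open>T > 0\<close> _ i, of B] unfolding force_centred by blast
  then show ?thesis by (rule LIM_zero_cancel)
qed

end

section \<open>Three oscillators\<close>

locale three_oscillators = kuramoto_trajectory 3 m \<kappa> \<nu> \<theta> \<omega>
  for m \<kappa> :: real and \<nu> :: "nat \<Rightarrow> real" and \<theta> \<omega> :: "nat \<Rightarrow> real \<Rightarrow> real" +
  assumes coupling_pos: "\<kappa> > 0"
begin

lemma third_oscillator:
  assumes "i \<in> {1..3}" "j \<in> {1..3}" "i \<noteq> j"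
  obtains k where "{1..3::nat} = {i, j, k}" "k \<noteq> i" "k \<noteq> j"
proof -
  have eq: "{1..3::nat} = {1, 2, 3}" by auto
  have "6 - i - j \<in> {1, 2, 3}" "{1, 2, 3} = {i, j, 6 - i - j}" "6 - i - j \<noteq> i" "6 - i - j \<noteq> j"
    using assms unfolding eq by auto
  then show ?thesis using that unfolding eq by metis
qed

context
  fixes i j k :: nat
  assumes ijk: "{1..3::nat} = {i, j, k}" "i \<noteq> j" "k \<noteq> i" "k \<noteq> j"
begin

text \<open>
  The influence of the third oscillator on the pair, by sum-to-product, factors through
  \<open>sin (x / 2)\<close>; only the second factor depends on where it is.
\<close>

lemma force_difference:
  "force i t - force j t = \<nu> i - \<nu> j - 2 * \<kappa> / 3 *
     (sin (\<theta> i t - \<theta> j t) + sin ((\<theta> i t - \<theta> j t) / 2) * cos (\<theta> k t - (\<theta> i t + \<theta> j t) / 2))"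
proof -
  have third: "sin (\<theta> k t - \<theta> i t) - sin (\<theta> k t - \<theta> j t)
      = 2 * sin (- ((\<theta> i t - \<theta> j t) / 2)) * cos (\<theta> k t - (\<theta> i t + \<theta> j t) / 2)"
  proof -
    have args: "(\<theta> k t - \<theta> i t - (\<theta> k t - \<theta> j t)) / 2 = - ((\<theta> i t - \<theta> j t) / 2)"
      "(\<theta> k t - \<theta> i t + (\<theta> k t - \<theta> j t)) / 2 = \<theta> k t - (\<theta> i t + \<theta> j t) / 2"
      by (simp_all add: field_simps)
    show ?thesis unfolding sin_diff_sin args ..
  qed
  have flip: "sin (\<theta> j t - \<theta> i t) = - sin (\<theta> i t - \<theta> j t)"
    by (simp flip: sin_minus)
  have "force i t - force j t = \<nu> i - \<nu> j + \<kappa> / 3 *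
      (sin (\<theta> j t - \<theta> i t) - sin (\<theta> i t - \<theta> j t) + (sin (\<theta> k t - \<theta> i t) - sin (\<theta> k t - \<theta> j t)))"
    unfolding coupled_force_def ijk(1) using ijk(2-4) by (auto simp: algebra_simps)
  then show ?thesis unfolding third flip by (simp add: algebra_simps)
qed

lemma force_third:
  "force k t = \<nu> k - 2 * \<kappa> / 3 *
     (cos ((\<theta> i t - \<theta> j t) / 2) * sin (\<theta> k t - (\<theta> i t + \<theta> j t) / 2))"
proof -
  have pair: "sin (\<theta> i t - \<theta> k t) + sin (\<theta> j t - \<theta> k t)
      = 2 * sin (- (\<theta> k t - (\<theta> i t + \<theta> j t) / 2)) * cos ((\<theta> i t - \<theta> j t) / 2)"
  proof -
    have args: "(\<theta> i t - \<theta> k t + (\<theta> j t - \<theta> k t)) / 2 = - (\<theta> k t - (\<theta> i t + \<theta> j t) / 2)"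
      "(\<theta> i t - \<theta> k t - (\<theta> j t - \<theta> k t)) / 2 = (\<theta> i t - \<theta> j t) / 2"
      by (simp_all add: field_simps)
    show ?thesis unfolding sin_plus_sin args ..
  qed
  have "force k t = \<nu> k + \<kappa> / 3 * (sin (\<theta> i t - \<theta> k t) + sin (\<theta> j t - \<theta> k t))"
    unfolding coupled_force_def ijk(1) using ijk(2-4) by (auto simp: algebra_simps)
  then show ?thesis unfolding pair sin_minus by (simp add: algebra_simps)
qed

lemma force_difference_le:
  "force i t - force j t \<le>
     \<nu> i - \<nu> j - 2 * \<kappa> / 3 * (sin (\<theta> i t - \<theta> j t) - \<bar>sin ((\<theta> i t - \<theta> j t) / 2)\<bar>)"
proof -
  let ?p = "sin ((\<theta> i t - \<theta> j t) / 2) * cos (\<theta> k t - (\<theta> i t + \<theta> j t) / 2)"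
  have "\<bar>?p\<bar> \<le> \<bar>sin ((\<theta> i t - \<theta> j t) / 2)\<bar>"
    unfolding abs_mult by (rule mult_left_le) auto
  then have "- ?p \<le> \<bar>sin ((\<theta> i t - \<theta> j t) / 2)\<bar>" by linarith
  then have "2 * \<kappa> / 3 * (sin (\<theta> i t - \<theta> j t) - \<bar>sin ((\<theta> i t - \<theta> j t) / 2)\<bar>)
      \<le> 2 * \<kappa> / 3 * (sin (\<theta> i t - \<theta> j t) + ?p)"
    using coupling_pos by (intro mult_left_mono) auto
  then show ?thesis unfolding force_difference by linarith
qed

lemma abs_force_difference_le: "\<bar>force i t - force j t\<bar> \<le> \<bar>\<nu> i - \<nu> j\<bar> + 2 * \<kappa>"
proof -
  let ?p = "sin ((\<theta> i t - \<theta> j t) / 2) * cos (\<theta> k t - (\<theta> i t + \<theta> j t) / 2)"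
  have "\<bar>?p\<bar> \<le> 1"
    unfolding abs_mult by (rule mult_le_one) auto
  then have "\<bar>sin (\<theta> i t - \<theta> j t) + ?p\<bar> \<le> 2"
    using abs_sin_le_one[of "\<theta> i t - \<theta> j t"] by linarith
  then have "\<bar>2 * \<kappa> / 3 * (sin (\<theta> i t - \<theta> j t) + ?p)\<bar> \<le> 2 * \<kappa> / 3 * 2"
    unfolding abs_mult[of "2 * \<kappa> / 3"] using coupling_pos by (intro mult_mono) auto
  then show ?thesis unfolding force_difference using coupling_pos by linarith
qed

text \<open>
  The barrier argument, applied to the difference \<open>X\<close> of the shifted phases.  The error \<open>\<mu>\<close> between \<open>X\<close> and the
  phase difference costs at most \<open>3 / 2 \<mu>\<close> in \<open>sin x - \<bar>sin (x / 2)\<bar>\<close>, whose Lipschitz constant is \<open>3 / 2\<close>,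
  and the hypothesis multiplied by \<open>2 \<kappa>\<close> reads \<open>D + \<kappa> \<mu> < 2 \<kappa> \<delta>\<close>: at a barrier, where
  \<open>sin x - \<bar>sin (x / 2)\<bar>\<close> equals \<open>3 \<delta>\<close>, the force difference is negative in spite of the error.
\<close>

lemma phase_difference_bounded_above:
  assumes D: "\<bar>\<nu> i - \<nu> j\<bar> \<le> D"
    and small: "m * D + 2 * m * \<kappa> + D / (2 * \<kappa>) < 1 / 8 * sqrt (1 / 6 * (69 - 11 * sqrt 33))"
  shows "\<exists>B. \<forall>\<^sub>F t in at_top. \<theta> i t - \<theta> j t \<le> B"
proof -
  have ij: "i \<in> {1..3}" "j \<in> {1..3}" using ijk(1) by auto
  define \<delta> where "\<delta> = 1 / 8 * sqrt (1 / 6 * (69 - 11 * sqrt 33))"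
  define \<mu> where "\<mu> = 2 * m * (D + 2 * \<kappa>)"
  have "2 * \<kappa> * (m * D + 2 * m * \<kappa> + D / (2 * \<kappa>)) < 2 * \<kappa> * \<delta>"
    using small coupling_pos by (simp add: \<delta>_def)
  moreover have "2 * \<kappa> * (m * D + 2 * m * \<kappa> + D / (2 * \<kappa>)) = D + \<kappa> * \<mu>"
    using coupling_pos by (simp add: \<mu>_def field_simps)
  ultimately have margin: "D + \<kappa> * \<mu> < 2 * \<kappa> * \<delta>" by simp
  have "\<forall>\<^sub>F t in at_top. \<bar>\<omega> i t - \<omega> j t\<bar> \<le> 2 * (D + 2 * \<kappa>)"
  proof (rule eventually_relaxed[OF m_pos, of "D + 2 * \<kappa>" 1 _ "\<lambda>t. force i t - force j t"])
    show "D + 2 * \<kappa> > 0" using D coupling_pos by linarith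
  next
    fix s :: real assume "s \<ge> 1"
    then show "((\<lambda>t. \<omega> i t - \<omega> j t) has_real_derivative
        (force i s - force j s - (\<omega> i s - \<omega> j s)) / m) (at s)"
      using ij by (auto intro!: derivative_eq_intros frequency_deriv simp: diff_divide_distrib)
    show "\<bar>force i s - force j s\<bar> \<le> D + 2 * \<kappa>"
      using abs_force_difference_le[of s] D by linarith
  qed
  then obtain S where S: "\<And>t. t \<ge> S \<Longrightarrow> \<bar>\<omega> i t - \<omega> j t\<bar> \<le> 2 * (D + 2 * \<kappa>)"
    unfolding eventually_at_top_linorder by blast
  define T where "T = max S 1"
  define X where "X t = (\<theta> i t + m * \<omega> i t) - (\<theta> j t + m * \<omega> j t)" for t
  have X_near: "\<bar>\<theta> i t - \<theta> j t - X t\<bar> \<le> \<mu>" if "t \<ge> T" for t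
  proof -
    have "\<theta> i t - \<theta> j t - X t = - (m * (\<omega> i t - \<omega> j t))"
      by (simp add: X_def algebra_simps)
    then have "\<bar>\<theta> i t - \<theta> j t - X t\<bar> = m * \<bar>\<omega> i t - \<omega> j t\<bar>"
      using m_pos by (simp add: abs_mult)
    also have "\<dots> \<le> m * (2 * (D + 2 * \<kappa>))"
      using S that m_pos by (intro mult_left_mono) (auto simp: T_def)
    finally show ?thesis by (simp add: \<mu>_def algebra_simps)
  qed
  have X_deriv: "(X has_real_derivative force i t - force j t) (at t)" if "t \<ge> T" for t
  proof -
    have "t > 0" using that by (simp add: T_def)
    then show ?thesis
      unfolding X_def using ij m_pos
      by (auto intro!: derivative_eq_intros phase_deriv frequency_deriv)
  qed
  \<comment> \<open>Barriers recur with period \<open>2 \<pi>\<close>, so one of them lies above the starting value.\<close>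
  obtain n :: nat where n: "(X T - 2 * threshold_angle) / (2 * pi) < real n"
    using reals_Archimedean2 by blast
  define c where "c = 2 * (threshold_angle + real n * pi)"
  have "X T < c" using n by (simp add: c_def field_simps)
  have sin_c: "sin c = sin (2 * threshold_angle)"
    unfolding c_def distrib_left sin_add using sin_npi[of "2 * n"] cos_npi[of "2 * n"]
    by (simp add: mult.assoc)
  have abs_sin_c: "\<bar>sin (c / 2)\<bar> = \<bar>sin threshold_angle\<bar>"
  proof -
    have "c / 2 = threshold_angle + real n * pi" by (simp add: c_def)
    then show ?thesis by (simp only: sin_add sin_npi cos_npi) (simp add: abs_mult power_abs)
  qed
  have barrier: "force i t - force j t < 0" if "t \<ge> T" "X t = c" for t
  proof -
    let ?x = "\<theta> i t - \<theta> j t"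
    have near: "\<bar>?x - c\<bar> \<le> \<mu>" using X_near that by metis
    have "\<bar>sin ?x - sin c\<bar> \<le> \<mu>"
      using abs_sin_diff_le near by (rule order_trans)
    moreover have "\<bar>sin (?x / 2) - sin (c / 2)\<bar> \<le> \<mu> / 2"
    proof -
      have "\<bar>?x / 2 - c / 2\<bar> \<le> \<mu> / 2"
        using near by (simp flip: diff_divide_distrib)
      with abs_sin_diff_le show ?thesis by (rule order_trans)
    qed
    moreover have "sin c - \<bar>sin (c / 2)\<bar> = 3 * \<delta>"
      unfolding sin_c abs_sin_c threshold_angle_value \<delta>_def ..
    ultimately have "sin ?x - \<bar>sin (?x / 2)\<bar> \<ge> 3 * \<delta> - 3 / 2 * \<mu>" by linarith
    then have "2 * \<kappa> / 3 * (sin ?x - \<bar>sin (?x / 2)\<bar>) \<ge> 2 * \<kappa> / 3 * (3 * \<delta> - 3 / 2 * \<mu>)"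
      using coupling_pos by (intro mult_left_mono) auto
    also have "2 * \<kappa> / 3 * (3 * \<delta> - 3 / 2 * \<mu>) = 2 * \<kappa> * \<delta> - \<kappa> * \<mu>"
      by (simp add: field_simps)
    finally show ?thesis
      using force_difference_le[of t] D margin by linarith
  qed
  have "\<theta> i t - \<theta> j t \<le> c + \<mu>" if "t \<ge> T" for t
    using barrier_from_below[OF X_deriv barrier \<open>X T < c\<close> that] X_near[OF that] by linarith
  then show ?thesis
    using eventually_ge_at_top[of T] by (blast intro: eventually_mono)
qed

text \<open>
  At every time the phases are an equilibrium for modified natural frequencies, namely those obtained
  by subtracting the current forces.  Hence the resultant vanishes identically for the modified
  parameters; at the recurring times \<open>cos x\<close> is fixed, and the parameters converge.
\<close>

lemma recurrent_phase_difference: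
  assumes lim: "\<And>l. l \<in> {1..3} \<Longrightarrow> (force l \<longlongrightarrow> \<Omega>) at_top"
    and recur: "\<exists>\<^sub>F t in at_top. \<theta> i t - \<theta> j t = x"
  shows "equilibrium_resultant ((\<nu> i - \<nu> j) / \<kappa>) ((\<nu> k - \<Omega>) / \<kappa>) (cos x) = 0"
proof -
  define d where "d t = (\<nu> i - \<nu> j - (force i t - force j t)) / \<kappa>" for t
  define a where "a t = (\<nu> k - force k t) / \<kappa>" for t
  have ijk_in: "i \<in> {1..3}" "j \<in> {1..3}" "k \<in> {1..3}" using ijk(1) by auto
  have "((\<lambda>t. force i t - force j t) \<longlongrightarrow> 0) at_top"
    using tendsto_diff[OF lim[OF ijk_in(1)] lim[OF ijk_in(2)]] by simp
  then have "(d \<longlongrightarrow> (\<nu> i - \<nu> j - 0) / \<kappa>) at_top"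
    unfolding d_def using coupling_pos by (intro tendsto_intros) auto
  moreover have "(a \<longlongrightarrow> (\<nu> k - \<Omega>) / \<kappa>) at_top"
    unfolding a_def using coupling_pos by (intro tendsto_intros lim ijk_in) auto
  ultimately have "((\<lambda>t. equilibrium_resultant (d t) (a t) (cos x)) \<longlongrightarrow>
      equilibrium_resultant ((\<nu> i - \<nu> j - 0) / \<kappa>) ((\<nu> k - \<Omega>) / \<kappa>) (cos x)) at_top"
    (is "(?R \<longlongrightarrow> ?L) _")
    unfolding equilibrium_resultant_def by (intro tendsto_intros)
  moreover have "\<exists>\<^sub>F t in at_top. ?R t = 0"
    using recur
  proof (rule frequently_elim1)
    fix t assume x: "\<theta> i t - \<theta> j t = x"
    show "?R t = 0"
    proof (rule equilibrium_resultant_eq_0)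
      show "3 / 2 * d t = sin x + sin (x / 2) * cos (\<theta> k t - (\<theta> i t + \<theta> j t) / 2)"
        unfolding d_def force_difference x using coupling_pos by (simp add: field_simps)
      show "3 / 2 * a t = cos (x / 2) * sin (\<theta> k t - (\<theta> i t + \<theta> j t) / 2)"
        unfolding a_def force_third x using coupling_pos by (simp add: field_simps)
    qed
  qed
  ultimately have "?L = 0"
    using tendsto_imp_eventually_ne[of ?R ?L at_top 0] unfolding frequently_def by blast
  then show ?thesis by simp
qed

end

lemma phase_locking:
  assumes D: "\<And>i j. i \<in> {1..3} \<Longrightarrow> j \<in> {1..3} \<Longrightarrow> \<bar>\<nu> i - \<nu> j\<bar> \<le> D"
    and small: "m * D + 2 * m * \<kappa> + D / (2 * \<kappa>) < 1 / 8 * sqrt (1 / 6 * (69 - 11 * sqrt 33))"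
  shows "asymptotic_phase_locking 3 \<theta>"
proof -
  let ?I = "{1..3::nat}"
  have upper: "\<exists>B. \<forall>\<^sub>F t in at_top. \<theta> i t - \<theta> j t \<le> B" if ij: "i \<in> ?I" "j \<in> ?I" for i j
  proof (cases "i = j")
    case False
    then obtain k where "?I = {i, j, k}" "k \<noteq> i" "k \<noteq> j"
      using third_oscillator ij by blast
    then show ?thesis
      using phase_difference_bounded_above[OF _ False] D[OF ij] small by blast
  qed auto
  then have "\<forall>p\<in>?I \<times> ?I. \<exists>B. \<forall>\<^sub>F t in at_top. \<theta> (fst p) t - \<theta> (snd p) t \<le> B" by auto
  then obtain b where b: "\<forall>p\<in>?I \<times> ?I. \<forall>\<^sub>F t in at_top. \<theta> (fst p) t - \<theta> (snd p) t \<le> b p"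
    unfolding bchoice_iff by blast
  define B where "B = Max (b ` (?I \<times> ?I))"
  have "\<forall>\<^sub>F t in at_top. \<forall>p\<in>?I \<times> ?I. \<theta> (fst p) t - \<theta> (snd p) t \<le> b p"
    using b by (intro eventually_ball_finite) auto
  then obtain S where S: "\<And>t p. t \<ge> S \<Longrightarrow> p \<in> ?I \<times> ?I \<Longrightarrow> \<theta> (fst p) t - \<theta> (snd p) t \<le> b p"
    unfolding eventually_at_top_linorder by blast
  define T where "T = max S 1"
  have le_B: "\<theta> i t - \<theta> j t \<le> B" if "i \<in> ?I" "j \<in> ?I" "t \<ge> T" for i j t
  proof -
    have "\<theta> i t - \<theta> j t \<le> b (i, j)"
      using S[of t "(i, j)"] that by (auto simp: T_def)
    also have "\<dots> \<le> B"
      unfolding B_def using that by (intro Max_ge) auto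
    finally show ?thesis .
  qed
  have bdd: "\<bar>\<theta> i t - \<theta> j t\<bar> \<le> B" if "i \<in> ?I" "j \<in> ?I" "t \<ge> T" for i j t
    using le_B[OF that] le_B[OF that(2,1,3)] by linarith
  have "T > 0" by (simp add: T_def)
  have lim: "(force l \<longlongrightarrow> mean \<nu>) at_top" if "l \<in> ?I" for l
    using force_tendsto_mean[OF \<open>T > 0\<close> that bdd] .
  have "\<exists>L. ((\<lambda>t. \<theta> i t - \<theta> j t) \<longlongrightarrow> L) at_top" if ij: "i \<in> ?I" "j \<in> ?I" for i j
  proof (cases "i = j")
    case False
    then obtain k where k: "?I = {i, j, k}" "k \<noteq> i" "k \<noteq> j"
      using third_oscillator ij by blast
    let ?roots = "{u. equilibrium_resultant ((\<nu> i - \<nu> j) / \<kappa>) ((\<nu> k - mean \<nu>) / \<kappa>) u = 0}"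
    show ?thesis
    proof (rule convergent_if_countable_recurrent_values)
      show "continuous_on {T..} (\<lambda>t. \<theta> i t - \<theta> j t)"
        using ij \<open>T > 0\<close>
        by (intro DERIV_continuous_on[where D = "\<lambda>t. \<omega> i t - \<omega> j t"]
            has_field_derivative_at_within[OF DERIV_diff] phase_deriv) auto
      show "\<bar>\<theta> i t - \<theta> j t\<bar> \<le> B" if "t \<ge> T" for t
        using bdd[OF ij that] .
      show "countable (\<Union>u\<in>?roots. {x. cos x = u})"
        using finite_equilibrium_resultant_roots
        by (intro countable_UN countable_finite countable_cos_fibre)
      show "x \<in> (\<Union>u\<in>?roots. {x. cos x = u})" if "\<exists>\<^sub>F t in at_top. \<theta> i t - \<theta> j t = x" for x
        using recurrent_phase_difference[OF k(1) False k(2,3) lim that] by simp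
    qed
  qed (auto intro: tendsto_const)
  then show ?thesis unfolding asymptotic_phase_locking_def by blast
qed

end

lemma abs_diff_le_frequency_diameter:
  assumes "i \<in> {1..N}" "j \<in> {1..N}"
  shows "\<bar>\<nu> i - \<nu> j\<bar> \<le> frequency_diameter N \<nu>"
  unfolding frequency_diameter_def
  by (rule Max_ge) (use assms in \<open>auto intro!: image_eqI[of _ _ "(i, j)"]\<close>)

theorem theorem1p2:
  fixes m \<kappa> :: real and \<nu> :: "nat \<Rightarrow> real"
  assumes "m > 0" and "\<kappa> > 0"
    and "m * frequency_diameter 3 \<nu> + 2 * m * \<kappa> + frequency_diameter 3 \<nu> / (2 * \<kappa>)
           < 1 / 8 * sqrt (1 / 6 * (69 - 11 * sqrt 33))"
  shows "\<forall>\<theta>0 \<omega>0 \<theta>. inertial_kuramoto_solution 3 m \<kappa> \<nu> \<theta>0 \<omega>0 \<theta>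
           \<longrightarrow> asymptotic_phase_locking 3 \<theta>"
proof (intro allI impI)
  fix \<theta>0 \<omega>0 \<theta> assume "inertial_kuramoto_solution 3 m \<kappa> \<nu> \<theta>0 \<omega>0 \<theta>"
  then obtain \<omega> where phase: "\<And>i t. i \<in> {1..3} \<Longrightarrow> t \<ge> 0 \<Longrightarrow>
      (\<theta> i has_real_derivative \<omega> i t) (at t within {0..})"
    and freq: "\<And>i t. i \<in> {1..3} \<Longrightarrow> t > 0 \<Longrightarrow> \<exists>a. (\<omega> i has_real_derivative a) (at t) \<and>
      m * a + \<omega> i t = \<nu> i + \<kappa> / real 3 * (\<Sum>j\<in>{1..3}. sin (\<theta> j t - \<theta> i t))"
    unfolding inertial_kuramoto_solution_def by blast
  interpret three_oscillators m \<kappa> \<nu> \<theta> \<omega>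
  proof
    fix i :: nat and t :: real assume i: "i \<in> {1..3}" and t: "t > 0"
    have "at t within {0..} = at t"
      by (rule at_within_interior) (use t in simp)
    then show "(\<theta> i has_real_derivative \<omega> i t) (at t)"
      using phase[OF i, of t] t by simp
    obtain a where a: "(\<omega> i has_real_derivative a) (at t)"
      "m * a + \<omega> i t = coupled_force 3 \<kappa> \<nu> \<theta> i t"
      using freq[OF i t] unfolding coupled_force_def by blast
    from a(2) have "a = (coupled_force 3 \<kappa> \<nu> \<theta> i t - \<omega> i t) / m"
      using \<open>m > 0\<close> by (simp add: field_simps)
    with a(1) show "(\<omega> i has_real_derivative (coupled_force 3 \<kappa> \<nu> \<theta> i t - \<omega> i t) / m) (at t)"
      by simp
  qed (fact assms)+
  show "asymptotic_phase_locking 3 \<theta>"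
    using abs_diff_le_frequency_diameter assms(3) by (rule phase_locking)
qed

end
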